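(* There are uncountably many pairwise non-isomorphic Puiseux monoids (i.e., the collection of isomorphism classes of Puiseux monoids is uncountable).
   Context: A Puiseux monoid is an additive submonoid of $\mathbb{Q}_{\ge 0}$ (the nonnegative rational numbers). Isomorphism means isomorphism of monoids. *)

theory Defs
  imports Complex_Main "HOL-Algebra.Group" "HOL-Library.Countable_Set"
begin

definition nonneg_rat_monoid :: "rat monoid" where
  "nonneg_rat_monoid = \<lparr>carrier = {q. 0 \<le> q}, mult = (+), one = 0\<rparr>"

definition puiseux_monoid :: "rat set \<Rightarrow> bool" where
  "puiseux_monoid M \<longleftrightarrow> submonoid M nonneg_rat_monoid"

text \<open>The relation \<open>\<cong>\<close> of \<open>HOL-Algebra.Group\<close> asks for a multiplicative bijection; that such a
  map between monoids also preserves the unit is \<open>monoid_iso_one\<close> below.\<close>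

definition puiseux_iso_rel :: "(rat set \<times> rat set) set" where
  "puiseux_iso_rel = {(M, N). puiseux_monoid M \<and> puiseux_monoid N \<and>
     nonneg_rat_monoid\<lparr>carrier := M\<rparr> \<cong> nonneg_rat_monoid\<lparr>carrier := N\<rparr>}"

definition puiseux_iso_classes :: "rat set set set" where
  "puiseux_iso_classes = {M. puiseux_monoid M} // puiseux_iso_rel"

lemma puiseux_monoid_iff:
  "puiseux_monoid M \<longleftrightarrow> M \<subseteq> {0..} \<and> 0 \<in> M \<and> (\<forall>x\<in>M. \<forall>y\<in>M. x + y \<in> M)"
  by (auto simp: puiseux_monoid_def submonoid_def nonneg_rat_monoid_def)

lemma monoid_iso_one:
  assumes G: "monoid G" and H: "monoid H" and f: "f \<in> iso G H"
  shows "f \<one>\<^bsub>G\<^esub> = \<one>\<^bsub>H\<^esub>"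
proof -
  interpret G: monoid G by (rule G)
  interpret H: monoid H by (rule H)
  have hom: "f \<in> hom G H" and img: "f ` carrier G = carrier H"
    using f by (auto simp: iso_iff)
  from img H.one_closed obtain e where e: "e \<in> carrier G" "f e = \<one>\<^bsub>H\<^esub>"
    by (metis imageE)
  have "f \<one>\<^bsub>G\<^esub> = f \<one>\<^bsub>G\<^esub> \<otimes>\<^bsub>H\<^esub> f e"
    using e hom_in_carrier[OF hom G.one_closed] by simp
  also have "\<dots> = f (\<one>\<^bsub>G\<^esub> \<otimes>\<^bsub>G\<^esub> e)"
    using hom e(1) by (simp add: hom_mult del: G.l_one)
  finally show ?thesis using e by simp
qed

lemma equiv_puiseux_iso_rel: "equiv {M. puiseux_monoid M} puiseux_iso_rel"
proof (rule equivI)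
  show "puiseux_iso_rel \<subseteq> {M. puiseux_monoid M} \<times> {M. puiseux_monoid M}"
    by (auto simp: puiseux_iso_rel_def)
  show "refl_on {M. puiseux_monoid M} puiseux_iso_rel"
    by (auto simp: refl_on_def puiseux_iso_rel_def)
  show "trans puiseux_iso_rel"
    by (auto simp: puiseux_iso_rel_def intro!: transI intro: iso_trans)
  show "sym puiseux_iso_rel"
  proof (rule symI)
    fix M N assume "(M, N) \<in> puiseux_iso_rel"
    then have MN: "puiseux_monoid M" "puiseux_monoid N"
      and "nonneg_rat_monoid\<lparr>carrier := M\<rparr> \<cong> nonneg_rat_monoid\<lparr>carrier := N\<rparr>"
      by (auto simp: puiseux_iso_rel_def)
    then obtain f where bij: "bij_betw f M N"
      and add: "\<And>x y. x \<in> M \<Longrightarrow> y \<in> M \<Longrightarrow> f (x + y) = f x + f y"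
      by (auto simp: is_iso_def iso_def hom_def nonneg_rat_monoid_def)
    let ?g = "inv_into M f"
    have bij_g: "bij_betw ?g N M" by (rule bij_betw_inv_into[OF bij])
    have "?g (u + v) = ?g u + ?g v" if "u \<in> N" "v \<in> N" for u v
    proof -
      have gM: "?g u \<in> M" "?g v \<in> M" using bij_g that by (auto dest: bij_betwE)
      then have "f (?g u + ?g v) = u + v"
        using add that bij by (simp add: bij_betw_inv_into_right)
      moreover have "?g u + ?g v \<in> M" using gM MN(1) by (simp add: puiseux_monoid_iff)
      ultimately show ?thesis using bij by (metis bij_betw_inv_into_left)
    qed
    then have "?g \<in> iso (nonneg_rat_monoid\<lparr>carrier := N\<rparr>) (nonneg_rat_monoid\<lparr>carrier := M\<rparr>)"
      using bij_g by (auto simp: iso_def hom_def nonneg_rat_monoid_def dest: bij_betwE)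
    then show "(N, M) \<in> puiseux_iso_rel"
      using MN by (auto simp: puiseux_iso_rel_def is_iso_def)
  qed
qed

end

theory Submission
  imports Defs
begin

text \<open>A homomorphism between Puiseux monoids is multiplication by a rational, because any two
  positive elements have a common positive multiple. Hence every isomorphism class is countable,
  and it suffices to exhibit uncountably many Puiseux monoids: for any \<open>A \<subseteq> [1, 2)\<close>,
  the set \<open>{0} \<union> A \<union> [2, \<infinity>)\<close> is one.\<close>

text \<open>If \<open>y / x\<close> is the fraction \<open>a / b\<close> with positive
  \<open>a\<close> and \<open>b\<close>, then \<open>a * x = b * y\<close>.\<close>

lemma pos_rat_common_multiple:
  fixes x y :: rat
  assumes "0 < x" and "0 < y"
  obtains m n :: nat where "0 < m" and "of_nat m * x = of_nat n * y"
proof -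
  obtain a b where q: "quotient_of (y / x) = (a, b)" by fastforce
  have b: "b > 0" using quotient_of_denom_pos[OF q] .
  have yx: "y / x = of_int a / of_int b" using quotient_of_div[OF q] .
  with assms b have "0 < (of_int a :: rat)"
    by (metis divide_pos_pos of_int_0_less_iff zero_less_divide_iff less_asym)
  then have a: "a > 0" by simp
  have "of_nat (nat a) * x = of_nat (nat b) * y"
    using yx a b assms by (simp add: field_simps)
  then show thesis using a that[of "nat a" "nat b"] by simp
qed

lemma additive_on_of_nat_mult:
  fixes f :: "rat \<Rightarrow> rat"
  assumes M: "puiseux_monoid M"
    and add: "\<And>x y. x \<in> M \<Longrightarrow> y \<in> M \<Longrightarrow> f (x + y) = f x + f y"
    and x: "x \<in> M"
  shows "f (of_nat n * x) = of_nat n * f x"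
proof -
  have zero: "0 \<in> M" and plus: "\<And>x y. x \<in> M \<Longrightarrow> y \<in> M \<Longrightarrow> x + y \<in> M"
    using M by (auto simp: puiseux_monoid_iff)
  \<comment> \<open>Membership is carried through the induction because \<open>add\<close> applies
    only to elements of \<open>M\<close>. The base case cancels in
    \<open>f 0 = f 0 + f 0\<close>.\<close>
  have "of_nat n * x \<in> M \<and> f (of_nat n * x) = of_nat n * f x"
  proof (induction n)
    case 0
    then show ?case using zero add[OF zero zero] by simp
  next
    case (Suc n)
    then show ?case using x add plus by (simp add: distrib_right)
  qed
  then show ?thesis ..
qed

text \<open>Fix a positive \<open>x\<close> in \<open>M\<close>. From \<open>m * y = n * x\<close>
  follows \<open>m * f y = n * f x\<close>, and cancelling \<open>m\<close> forces the factor
  \<open>f x / x\<close> for every \<open>y\<close>. If \<open>M\<close> is trivial, only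
  \<open>f 0 = 0\<close> remains to be checked.\<close>

lemma additive_on_puiseux_monoid_scaling:
  fixes f :: "rat \<Rightarrow> rat"
  assumes M: "puiseux_monoid M"
    and add: "\<And>x y. x \<in> M \<Longrightarrow> y \<in> M \<Longrightarrow> f (x + y) = f x + f y"
  shows "\<exists>q. \<forall>x\<in>M. f x = q * x"
proof (cases "\<exists>x\<in>M. 0 < x")
  case True
  then obtain x where x: "x \<in> M" "0 < x" by blast
  have "f y = f x / x * y" if y: "y \<in> M" for y
  proof (cases "y = 0")
    case True
    then show ?thesis using additive_on_of_nat_mult[OF M add y, of 0] by simp
  next
    case False
    then have "0 < y" using M y by (force simp: puiseux_monoid_iff)
    then obtain m n :: nat where m: "0 < m" and mn: "of_nat m * y = of_nat n * x"
      using pos_rat_common_multiple x(2) by metis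
    have "of_nat m * f y = of_nat n * f x"
      using additive_on_of_nat_mult[OF M add] y x(1) mn by metis
    also have "\<dots> = f x / x * (of_nat n * x)" using x(2) by simp
    also have "\<dots> = of_nat m * (f x / x * y)" unfolding mn[symmetric] by simp
    finally show ?thesis using m by (simp only: mult_cancel_left of_nat_eq_0_iff) simp
  qed
  then show ?thesis by blast
next
  case False
  then have "x = 0" if "x \<in> M" for x using M that by (force simp: puiseux_monoid_iff)
  moreover have "f 0 = 0"
    using additive_on_of_nat_mult[OF M add, of 0 0] M by (simp add: puiseux_monoid_iff)
  ultimately have "\<forall>x\<in>M. f x = 0 * x" by fastforce
  then show ?thesis ..
qed

text \<open>Each member of the class of \<open>M\<close> is a dilate of \<open>M\<close> by some
  rational, and there are only countably many rationals.\<close>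

lemma countable_puiseux_iso_class:
  assumes "C \<in> puiseux_iso_classes"
  shows "countable C"
proof -
  obtain M where M: "puiseux_monoid M" and C: "C = puiseux_iso_rel `` {M}"
    using assms by (auto simp: puiseux_iso_classes_def elim: quotientE)
  have "C \<subseteq> range (\<lambda>q. (*) q ` M)"
  proof
    fix N assume "N \<in> C"
    then obtain f where bij: "bij_betw f M N"
      and add: "\<And>x y. x \<in> M \<Longrightarrow> y \<in> M \<Longrightarrow> f (x + y) = f x + f y"
      by (auto simp: C puiseux_iso_rel_def is_iso_def iso_def hom_def nonneg_rat_monoid_def)
    obtain q where "\<forall>x\<in>M. f x = q * x"
      using additive_on_puiseux_monoid_scaling[OF M add] by blast
    then have "N = (*) q ` M" using bij by (auto simp: bij_betw_def image_iff)
    then show "N \<in> range (\<lambda>q. (*) q ` M)" by blast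
  qed
  then show ?thesis by (rule countable_subset) simp
qed

lemma uncountable_UNIV_nat_set: "uncountable (UNIV :: nat set set)"
proof
  assume "countable (UNIV :: nat set set)"
  then have "range (from_nat_into (UNIV :: nat set set)) = UNIV"
    by (simp add: range_from_nat_into)
  then show False using Cantors_theorem[of "UNIV :: nat set"] by auto
qed

lemma uncountable_puiseux_monoids: "uncountable {M. puiseux_monoid M}"
proof -
  \<comment> \<open>The shift by 2 keeps \<open>g 0\<close> below 2; with \<open>n + 1\<close> it
    would be 2, which lies in every \<open>P S\<close>.\<close>
  define g :: "nat \<Rightarrow> rat" where "g n = 1 + 1 / of_nat (n + 2)" for n
  define P where "P S = {0} \<union> g ` S \<union> {2..}" for S
  have g: "1 < g n" "g n < 2" for n by (simp_all add: g_def)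
  have inj_g: "inj g" by (auto simp: inj_def g_def)
  have ge1: "x = 0 \<or> 1 \<le> x" if "x \<in> P S" for x S
    using that g(1) by (auto simp: P_def intro: less_imp_le)
  have "x + y \<in> P S" if xy: "x \<in> P S" "y \<in> P S" for x y S
  proof (cases "x = 0 \<or> y = 0")
    case True
    then show ?thesis using xy by auto
  next
    case False
    \<comment> \<open>Nonzero elements are at least 1, so the ray from 2 on absorbs their sums,
      whatever \<open>S\<close> is.\<close>
    then have "2 \<le> x + y" using ge1[OF xy(1)] ge1[OF xy(2)] by linarith
    then show ?thesis by (simp add: P_def)
  qed
  moreover have "P S \<subseteq> {0..}" "0 \<in> P S" for S
    using ge1[of _ S] by (force, simp add: P_def)
  ultimately have "range P \<subseteq> {M. puiseux_monoid M}"
    by (simp add: puiseux_monoid_iff image_subset_iff)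
  moreover have "inj P"
  proof (rule injI)
    fix S T assume "P S = P T"
    moreover have "n \<in> S \<longleftrightarrow> g n \<in> P S" for n S
      using g[of n] inj_g by (auto simp: P_def inj_image_mem_iff)
    ultimately show "S = T" by blast
  qed
  ultimately show ?thesis
    using uncountable_UNIV_nat_set countable_image_inj_on countable_subset by blast
qed

theorem proposition3p4:
  shows "uncountable puiseux_iso_classes"
proof
  assume "countable puiseux_iso_classes"
  \<comment> \<open>The classes partition all Puiseux monoids, so countably many countable classes
    would leave only countably many monoids.\<close>
  then have "countable (\<Union> puiseux_iso_classes)"
    using countable_UN[of puiseux_iso_classes "\<lambda>C. C"] countable_puiseux_iso_class by simp
  then show False
    using uncountable_puiseux_monoids Union_quotient[OF equiv_puiseux_iso_rel]
    by (simp add: puiseux_iso_classes_def)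
qed

end
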